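(* Let $k,n\in\mathbb{N}$ satisfy $1\le k\le n-1$. Then $$\frac{B_{n,k-1}(k/n)}{b_{n,k-1}(k/n)}<\sqrt{\frac{\pi}{2}}\,L(n,k-1,k/n).$$
   Context: $\mathbb{N}$ denotes the positive integers. For integers $0\le k\le n$ and $0<p<1$, $$b_{n,k}(p)=\binom{n}{k}p^k(1-p)^{n-k},\qquad B_{n,k}(p)=\sum_{j=0}^k b_{n,j}(p),$$ and $$L(n,k,p)=\frac{k+1-pn+\sqrt{(pn-k+1)^2+4(1-p)k}}{2}.$$ *)

theory Defs
  imports Complex_Main
begin

(* The functions are total; the intended domain is k \<le> n and 0 < p < 1. *)

definition binom_prob :: "nat \<Rightarrow> nat \<Rightarrow> real \<Rightarrow> real" where
  "binom_prob n k p = real (n choose k) * p ^ k * (1 - p) ^ (n - k)"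

definition binom_cdf :: "nat \<Rightarrow> nat \<Rightarrow> real \<Rightarrow> real" where
  "binom_cdf n k p = (\<Sum>j = 0..k. binom_prob n j p)"

definition L :: "nat \<Rightarrow> nat \<Rightarrow> real \<Rightarrow> real" where
  "L n k p = (real k + 1 - p * real n
     + sqrt ((p * real n - real k + 1)\<^sup>2 + 4 * (1 - p) * real k)) / 2"

end

theory Submission
  imports Defs "HOL-Probability.Distributions"
begin

text \<open>
  Write \<open>m = n - k\<close>, \<open>\<mu> = m / k\<close>, \<open>p = k / n\<close>. Integrating the derivative of the binomial
  distribution function over \<open>[p, 1]\<close> along \<open>x = 1 - (1 - p) r\<^sup>2\<close> gives
  \<open>B / b = 2 (m + 1) \<integral> X ^ (k - 1) r ^ (2 m + 1) dr\<close> over \<open>[0, 1]\<close>, with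
  \<open>X = 1 + \<mu> - \<mu> r\<^sup>2\<close>. In the variable \<open>w\<close> with \<open>w 1 = 0\<close> and \<open>dw = - 2 dr / X\<close> the integrand
  becomes \<open>X ^ k r ^ (2 m + 1)\<close>, which is at most \<open>exp (- w / 2 - A w\<^sup>2 / 2)\<close>; here \<open>- 1 / 2\<close> and
  \<open>- A\<close> are the first two derivatives of its logarithm at \<open>w = 0\<close>. Bounding
  \<open>exp (- w / 2)\<close> by its quadratic Taylor polynomial leaves explicit Gaussian moments. The
  linear term \<open>- w / 2\<close> is what wins the factor \<open>sqrt (m / (m + 1))\<close> that the plain Gaussian
  bound obtained with \<open>(1 - s) ^ m\<close>, \<open>s = 1 - r\<^sup>2\<close>, and \<open>w = ln (1 + \<mu> s) / \<mu>\<close> would miss. Finally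
  \<open>L n (k - 1) p = sqrt ((m + 1) / (1 + \<mu>))\<close>.
\<close>

section \<open>Gaussian estimates on the half-line\<close>

lemma exp_minus_le_quadratic:
  fixes y :: real
  assumes "0 \<le> y"
  shows "exp (- y) \<le> 1 - y + y\<^sup>2 / 2"
proof -
  have "1 - 0 + 0\<^sup>2 / 2 - exp (- 0) \<le> 1 - y + y\<^sup>2 / 2 - exp (- y)"
  proof (rule DERIV_nonneg_imp_nondecreasing[OF assms])
    fix x :: real
    assume "0 \<le> x" "x \<le> y"
    have "((\<lambda>y. 1 - y + y\<^sup>2 / 2 - exp (- y)) has_real_derivative (x - 1 + exp (- x))) (at x)"
      by (auto intro!: derivative_eq_intros)
    moreover have "0 \<le> x - 1 + exp (- x)"
      using exp_ge_add_one_self[of "- x"] by linarith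
    ultimately show "\<exists>z. ((\<lambda>y. 1 - y + y\<^sup>2 / 2 - exp (- y)) has_real_derivative z) (at x) \<and> 0 \<le> z"
      by blast
  qed
  then show ?thesis by simp
qed

text \<open>The moments of order 0, 1, 2 of \<open>exp (- v\<^sup>2)\<close> on the half-line are
  \<open>sqrt pi / 2\<close>, \<open>1 / 2\<close>, \<open>sqrt pi / 4\<close>. The Bochner integral
  is turned into a gauge integral to allow comparison with integrals over
  \<open>{0..v}\<close>.\<close>

lemma has_integral_gaussian_quadratic:
  fixes e :: real
  shows "((\<lambda>v. exp (- v\<^sup>2) * (1 - e * v + (e * v)\<^sup>2 / 2))
           has_integral (sqrt pi / 2 - e / 2 + e\<^sup>2 * sqrt pi / 8)) {0..}"
proof -
  let ?M = "\<lambda>i (v::real). indicator {0..} v *\<^sub>R (exp (- v\<^sup>2) * v ^ i) :: real"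
  have "has_bochner_integral lborel (?M 0) (sqrt pi / 2)"
    using gaussian_moment_even_pos[of 0] by simp
  moreover have "has_bochner_integral lborel (?M 1) (1 / 2)"
    using gaussian_moment_odd_pos[of 0] by simp
  moreover have "has_bochner_integral lborel (?M 2) (sqrt pi / 4)"
    using gaussian_moment_even_pos[of 1] by (simp add: fact_numeral)
  ultimately have "has_bochner_integral lborel (\<lambda>v. ?M 0 v - e * ?M 1 v + e\<^sup>2 / 2 * ?M 2 v)
      (sqrt pi / 2 - e * (1 / 2) + e\<^sup>2 / 2 * (sqrt pi / 4))" (is "has_bochner_integral _ ?f ?I")
    by (intro has_bochner_integral_add has_bochner_integral_diff has_bochner_integral_mult_right)
  then have hb: "integrable lborel ?f" "integral\<^sup>L lborel ?f = ?I"
    by (auto simp only: has_bochner_integral_iff)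
  have "(?f has_integral ?I) UNIV"
    using has_integral_integral_lborel[OF hb(1)] by (simp only: hb(2))
  moreover have "?f = (\<lambda>v. if v \<in> {0..} then exp (- v\<^sup>2) * (1 - e * v + (e * v)\<^sup>2 / 2) else 0)"
    by (auto simp: algebra_simps power2_eq_square)
  ultimately have "((\<lambda>v. if v \<in> {0..} then exp (- v\<^sup>2) * (1 - e * v + (e * v)\<^sup>2 / 2) else 0)
      has_integral ?I) UNIV"
    by (simp only:)
  then have "((\<lambda>v. exp (- v\<^sup>2) * (1 - e * v + (e * v)\<^sup>2 / 2)) has_integral ?I) {0..}"
    unfolding has_integral_restrict_UNIV .
  then show ?thesis
    by simp
qed

text \<open>Supplies the Gaussian side as a differentiable function, so that the later comparison
  needs only derivatives and no substitution in an integral. The integrand is nonnegative, so each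
  value of \<open>g\<close> is at most the full half-line integral, rescaled by
  \<open>v = a * w\<close>.\<close>

lemma gaussian_primitive:
  fixes A :: real
  assumes A: "0 < A"
  obtains g where "g 0 = 0"
    and "\<And>w. 0 \<le> w \<Longrightarrow> (g has_real_derivative exp (- A * w\<^sup>2 / 2) * (1 - w / 2 + w\<^sup>2 / 8)) (at w)"
    and "\<And>w. 0 \<le> w \<Longrightarrow> g w \<le> sqrt (pi / 2) / sqrt A * (1 + 1 / (8 * A)) - 1 / (2 * A)"
proof -
  define a where "a = sqrt (A / 2)"
  have a: "0 < a" "a\<^sup>2 = A / 2"
    using A by (auto simp: a_def)
  define e where "e = 1 / (2 * a)"
  define f where "f = (\<lambda>v::real. exp (- v\<^sup>2) * (1 - e * v + (e * v)\<^sup>2 / 2))"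
  \<comment> \<open>Starting the integral at -1 makes 0 an interior point, so \<open>F\<close> has a
    two-sided derivative there; the subtracted constant gives \<open>F 0 = 0\<close>.\<close>
  define F where "F = (\<lambda>v. integral {- 1..v} f - integral {- 1..0} f)"
  have cont: "continuous_on S f" for S
    unfolding f_def by (intro continuous_intros) auto
  have f_nonneg: "0 \<le> f v" for v
  proof -
    have "1 - e * v + (e * v)\<^sup>2 / 2 = ((e * v - 1)\<^sup>2 + 1) / 2"
      by (simp add: power2_eq_square algebra_simps)
    also have "0 \<le> \<dots>" by simp
    finally show ?thesis unfolding f_def by simp
  qed
  have F_deriv: "(F has_real_derivative f v) (at v)" if "0 \<le> v" for v
  proof -
    have "((\<lambda>x. integral {- 1..x} f) has_real_derivative f v) (at v within {- 1..v + 1})"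
      using that by (intro integral_has_real_derivative cont) auto
    moreover have "at v within {- 1..v + 1} = at v"
      using that by (intro at_within_interior) auto
    ultimately show ?thesis
      unfolding F_def by (auto intro!: derivative_eq_intros)
  qed
  have F_le: "F v \<le> sqrt pi / 2 - e / 2 + e\<^sup>2 * sqrt pi / 8" if "0 \<le> v" for v
  proof -
    have "integral {- 1..0} f + integral {0..v} f = integral {- 1..v} f"
      using that by (intro Henstock_Kurzweil_Integration.integral_combine
          integrable_continuous_interval cont) auto
    then have "F v = integral {0..v} f"
      by (simp add: F_def)
    moreover have "(f has_integral integral {0..v} f) {0..v}"
      by (intro integrable_integral integrable_continuous_interval cont)
    moreover have "(f has_integral (sqrt pi / 2 - e / 2 + e\<^sup>2 * sqrt pi / 8)) {0..}"
      unfolding f_def by (rule has_integral_gaussian_quadratic)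
    ultimately show ?thesis
      using f_nonneg by (auto intro: has_integral_subset_le[of "{0..v}" "{0..}" f])
  qed
  define g where "g = (\<lambda>w. F (a * w) / a)"
  show thesis
  proof (rule that[of g])
    show "g 0 = 0"
      by (simp add: g_def F_def)
  next
    fix w :: real
    assume w: "0 \<le> w"
    have "((\<lambda>w. F (a * w)) has_real_derivative f (a * w) * a) (at w)"
      using a(1) w by (intro DERIV_chain2[OF F_deriv]) (auto intro!: derivative_eq_intros)
    then have "(g has_real_derivative f (a * w) * a / a) (at w)"
      unfolding g_def by (rule DERIV_cdivide)
    moreover have "f (a * w) * a / a = exp (- A * w\<^sup>2 / 2) * (1 - w / 2 + w\<^sup>2 / 8)"
    proof -
      have ew: "e * (a * w) = w / 2"
        using a(1) by (simp add: e_def)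
      have aw: "(a * w)\<^sup>2 = A * w\<^sup>2 / 2"
        by (simp add: power_mult_distrib a(2))
      show ?thesis
        unfolding f_def ew aw using a(1) by (simp add: power_divide)
    qed
    ultimately show "(g has_real_derivative exp (- A * w\<^sup>2 / 2) * (1 - w / 2 + w\<^sup>2 / 8)) (at w)"
      by simp
    have "g w \<le> (sqrt pi / 2 - e / 2 + e\<^sup>2 * sqrt pi / 8) / a"
      unfolding g_def using a(1) w by (intro divide_right_mono F_le) auto
    also have "\<dots> = sqrt pi / (2 * a) * (1 + e\<^sup>2 / 4) - e / (2 * a)"
      by (simp add: add_divide_distrib diff_divide_distrib distrib_left)
    also have "e\<^sup>2 / 4 = 1 / (8 * A)"
      by (simp add: e_def power_divide power_mult_distrib a(2))
    also have "e / (2 * a) = 1 / (2 * A)"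
      using a(2) by (simp add: e_def power2_eq_square)
    also have "sqrt pi / (2 * a) = sqrt (pi / 2) / sqrt A"
    proof -
      have "sqrt 2 * a = sqrt A"
        by (simp add: a_def real_sqrt_divide)
      then have "2 * a = sqrt 2 * sqrt A"
        by (metis mult.assoc real_sqrt_mult_self abs_numeral)
      then show ?thesis
        by (simp add: real_sqrt_divide)
    qed
    finally show "g w \<le> sqrt (pi / 2) / sqrt A * (1 + 1 / (8 * A)) - 1 / (2 * A)" .
  qed
qed

section \<open>Derivative of the binomial distribution function in \<open>p\<close>\<close>

text \<open>The sum of derivatives telescopes: by
  \<open>Suc k * (n choose Suc k) = (n - k) * (n choose k)\<close>, the positive part of the
  derivative of each new summand cancels the derivative of the preceding partial sum.\<close>

lemma binom_cdf_has_derivative: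
  assumes "k \<le> n"
  shows "(binom_cdf n k has_real_derivative
    - (real (n - k) * real (n choose k) * x ^ k * (1 - x) ^ (n - k - 1))) (at x)"
  using assms
proof (induction k)
  case 0
  have "binom_cdf n 0 = (\<lambda>x. (1 - x) ^ n)"
    by (auto simp: binom_cdf_def binom_prob_def)
  then show ?case
    by (auto intro!: derivative_eq_intros)
next
  case (Suc k)
  have eq: "binom_cdf n (Suc k) = (\<lambda>x. binom_cdf n k x + binom_prob n (Suc k) x)"
    by (auto simp: binom_cdf_def)
  have "Suc k * (n choose Suc k) = (n - k) * (n choose k)"
    by (simp only: binomial_absorption binomial_absorb_comp)
  then have c: "real (n choose Suc k) * real (Suc k) = real (n - k) * real (n choose k)"
    by (metis of_nat_mult mult.commute)
  have "(binom_cdf n k has_real_derivative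
    - (real (n - k) * real (n choose k) * x ^ k * (1 - x) ^ (n - k - 1))) (at x)"
    using Suc by simp
  moreover have "(binom_prob n (Suc k) has_real_derivative
     real (n choose Suc k) * real (Suc k) * x ^ k * (1 - x) ^ (n - Suc k)
     - real (n choose Suc k) * x ^ Suc k * (real (n - Suc k) * (1 - x) ^ (n - Suc k - 1))) (at x)"
    unfolding binom_prob_def[abs_def]
    by (rule derivative_eq_intros refl | simp)+
  ultimately have "(binom_cdf n (Suc k) has_real_derivative
     - (real (n - k) * real (n choose k) * x ^ k * (1 - x) ^ (n - k - 1))
     + (real (n choose Suc k) * real (Suc k) * x ^ k * (1 - x) ^ (n - Suc k)
     - real (n choose Suc k) * x ^ Suc k * (real (n - Suc k) * (1 - x) ^ (n - Suc k - 1)))) (at x)"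
    unfolding eq by (rule DERIV_add)
  then show ?case
    unfolding c by (simp add: algebra_simps)
qed

section \<open>The change of variable \<open>w\<close>\<close>

text \<open>The denominator factors as \<open>(1 + \<mu>) * (1 - (\<rho> * r)\<^sup>2)\<close> with
  \<open>\<rho>\<^sup>2 = \<mu> / (1 + \<mu>)\<close>, so a scaled artanh is a primitive;
  \<open>\<rho> < 1\<close> keeps it differentiable up to \<open>r = 1\<close>.\<close>

lemma artanh_primitive:
  fixes \<mu> :: real
  assumes \<mu>: "0 < \<mu>"
  obtains w where "w 1 = 0"
    and "\<And>r. 0 \<le> r \<Longrightarrow> r \<le> 1 \<Longrightarrow> (w has_real_derivative - 2 / (1 + \<mu> - \<mu> * r\<^sup>2)) (at r)"
    and "\<And>r. 0 \<le> r \<Longrightarrow> r \<le> 1 \<Longrightarrow> 0 \<le> w r"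
proof -
  define \<rho> where "\<rho> = sqrt (\<mu> / (1 + \<mu>))"
  have \<rho>: "0 < \<rho>" "\<rho> < 1" "\<rho>\<^sup>2 = \<mu> / (1 + \<mu>)"
    using \<mu> by (auto simp: \<rho>_def)
  define w where "w = (\<lambda>r. 2 / (\<rho> * (1 + \<mu>)) * (artanh \<rho> - artanh (\<rho> * r)))"
  have der: "(w has_real_derivative - 2 / (1 + \<mu> - \<mu> * r\<^sup>2)) (at r)" if r: "0 \<le> r" "r \<le> 1" for r
  proof -
    have "\<rho> * r \<le> \<rho>"
      using \<rho>(1) r by (simp add: mult_left_le)
    then have "\<rho> * r < 1"
      using \<rho>(2) by linarith
    then have "\<bar>\<rho> * r\<bar> < 1"
      using \<rho>(1) r(1) by simp
    then have "((\<lambda>r. artanh (\<rho> * r)) has_real_derivative 1 / (1 - (\<rho> * r)\<^sup>2) * \<rho>) (at r)"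
      by (intro DERIV_chain2[OF artanh_real_has_field_derivative])
        (auto intro!: derivative_eq_intros)
    then have "((\<lambda>r. artanh \<rho> - artanh (\<rho> * r)) has_real_derivative
        0 - 1 / (1 - (\<rho> * r)\<^sup>2) * \<rho>) (at r)"
      by (intro DERIV_diff DERIV_const)
    then have "(w has_real_derivative
        2 / (\<rho> * (1 + \<mu>)) * (0 - 1 / (1 - (\<rho> * r)\<^sup>2) * \<rho>)) (at r)"
      unfolding w_def by (rule DERIV_cmult)
    moreover have "1 + \<mu> - \<mu> * r\<^sup>2 = (1 + \<mu>) * (1 - (\<rho> * r)\<^sup>2)"
    proof -
      have "(1 + \<mu>) * (1 - (\<rho> * r)\<^sup>2) = 1 + \<mu> - (\<rho>\<^sup>2 * (1 + \<mu>)) * r\<^sup>2"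
        by (simp add: power_mult_distrib algebra_simps)
      also have "\<rho>\<^sup>2 * (1 + \<mu>) = \<mu>"
        using \<mu> by (simp add: \<rho>(3))
      finally show ?thesis ..
    qed
    moreover have "2 / (\<rho> * (1 + \<mu>)) * (0 - 1 / Y * \<rho>) = - 2 / ((1 + \<mu>) * Y)" for Y
      using \<rho>(1) by simp
    ultimately show ?thesis by simp
  qed
  have one: "w 1 = 0"
    by (simp add: w_def)
  have pos: "1 + \<mu> - \<mu> * x\<^sup>2 > 0" if "0 \<le> x" "x \<le> 1" for x
  proof -
    have "\<mu> * x\<^sup>2 \<le> \<mu>"
      using \<mu> that by (simp add: mult_left_le power_le_one)
    then show ?thesis by simp
  qed
  have "0 \<le> w r" if r: "0 \<le> r" "r \<le> 1" for r
  proof -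
    have "w 1 \<le> w r"
    proof (rule DERIV_nonpos_imp_nonincreasing[OF r(2)])
      fix x
      assume "r \<le> x" "x \<le> 1"
      then have x: "0 \<le> x" "x \<le> 1"
        using r by auto
      show "\<exists>y. (w has_real_derivative y) (at x) \<and> y \<le> 0"
        using der[OF x] pos[OF x] by (intro exI[of _ "- 2 / (1 + \<mu> - \<mu> * x\<^sup>2)"]) auto
    qed
    then show ?thesis using one by simp
  qed
  then show thesis
    using that[OF one der] by blast
qed

section \<open>Pointwise Gaussian bound for the weight\<close>

text \<open>As a function of \<open>w\<close>, the logarithm of the weight has second derivative
  \<open>- z * X / 4\<close>, with \<open>z\<close> as defined in the proof. This never exceeds its
  value \<open>- A\<close> at \<open>w = 0\<close>, so the second-order Taylor polynomial there is
  an upper bound.\<close>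

lemma weight_le_gaussian:
  fixes k m :: nat and \<mu> A r :: real and w :: "real \<Rightarrow> real"
  assumes k: "0 < k" and m: "0 < m"
    and \<mu>: "\<mu> = real m / real k"
    and A: "A = 1 / 4 + real m + (real m + 1 / 2) * \<mu>"
    and w1: "w 1 = 0"
    and w: "\<And>r. 0 \<le> r \<Longrightarrow> r \<le> 1 \<Longrightarrow> (w has_real_derivative - 2 / (1 + \<mu> - \<mu> * r\<^sup>2)) (at r)"
    and r: "0 < r" "r \<le> 1"
  shows "(1 + \<mu> - \<mu> * r\<^sup>2) ^ k * r ^ (2 * m + 1) \<le> exp (- w r / 2 - A * (w r)\<^sup>2 / 2)"
proof -
  have \<mu>_pos: "0 < \<mu>"
    using k m \<mu> by simp
  have k\<mu>: "real k * \<mu> = real m"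
    using k \<mu> by simp
  define X where "X = (\<lambda>r. 1 + \<mu> - \<mu> * r\<^sup>2)"
  define H where "H = (\<lambda>r. (2 * real m + 1) * X r / r - 2 * real m * r - 1 - 2 * A * w r)"
  \<comment> \<open>\<open>D' = H / X\<close>, and \<open>H\<close> decreases to \<open>H 1 = 0\<close>, so \<open>D\<close> increases to \<open>D 1 = 0\<close>.\<close>
  define D where "D = (\<lambda>r. real k * ln (X r) + (2 * real m + 1) * ln r + w r / 2 + A * (w r)\<^sup>2 / 2)"
  have X_ge: "1 \<le> X x" if "0 < x" "x \<le> 1" for x
    using \<mu>_pos that by (simp add: X_def mult_left_le power_le_one)
  have H_nonneg: "0 \<le> H x" if x: "0 < x" "x \<le> 1" for x
  proof -
    have "H 1 \<le> H x"
    proof (rule DERIV_nonpos_imp_nonincreasing[OF x(2)])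
      fix y
      assume "x \<le> y" "y \<le> 1"
      then have y: "0 < y" "y \<le> 1"
        using x by auto
      \<comment> \<open>\<open>- z\<close> is the derivative of the part of \<open>H\<close> free of
        \<open>w\<close>. At \<open>y = 1\<close> it equals \<open>- 4 * A\<close>, which is where
        the value of \<open>A\<close> comes from.\<close>
      define z where "z = (2 * real m + 1) * ((1 + \<mu>) / y\<^sup>2 + \<mu>) + 2 * real m"
      have "(w has_real_derivative - 2 / X y) (at y)"
        using w[of y] y by (simp add: X_def)
      moreover have "(X has_real_derivative - 2 * \<mu> * y) (at y)"
        unfolding X_def by (auto intro!: derivative_eq_intros)
      ultimately have "(H has_real_derivative
          ((2 * real m + 1) * (- 2 * \<mu> * y) * y - (2 * real m + 1) * X y) / (y * y)
            - 2 * real m - 2 * A * (- 2 / X y)) (at y)"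
        unfolding H_def using y(1) by (auto intro!: derivative_eq_intros)
      moreover have "((2 * real m + 1) * (- 2 * \<mu> * y) * y - (2 * real m + 1) * X y) / (y * y)
            - 2 * real m - 2 * A * (- 2 / X y) = 4 * A / X y - z"
      proof -
        have "((2 * real m + 1) * (- 2 * \<mu> * y) * y - (2 * real m + 1) * X y)
            = - ((2 * real m + 1) * ((1 + \<mu>) + \<mu> * (y * y)))"
          by (simp add: X_def power2_eq_square algebra_simps)
        moreover have "\<dots> / (y * y) = - ((2 * real m + 1) * ((1 + \<mu>) / y\<^sup>2 + \<mu>))"
        proof -
          have "((1 + \<mu>) + \<mu> * (y * y)) / (y * y) = (1 + \<mu>) / y\<^sup>2 + \<mu>"
            using y(1) by (simp add: power2_eq_square add_divide_distrib)
          then show ?thesis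
            by (simp only: times_divide_eq_right[symmetric] minus_divide_left[symmetric])
        qed
        ultimately show ?thesis
          by (simp add: z_def)
      qed
      moreover have "4 * A / X y \<le> z"
      proof -
        have "1 + \<mu> \<le> (1 + \<mu>) / y\<^sup>2"
          using y \<mu>_pos by (simp add: le_divide_eq mult_left_le power_le_one)
        then have "(2 * real m + 1) * ((1 + \<mu>) + \<mu>) + 2 * real m \<le> z"
          unfolding z_def by (intro add_right_mono mult_left_mono) auto
        then have "4 * A \<le> z"
          by (simp add: A algebra_simps)
        moreover have "0 \<le> A"
          using \<mu>_pos by (simp add: A)
        ultimately have "4 * A \<le> z * X y"
          using X_ge[OF y] mult_left_mono[of 1 "X y" z] by simp
        then show ?thesis
          using X_ge[OF y] by (simp add: divide_le_eq)
      qed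
      ultimately show "\<exists>u. (H has_real_derivative u) (at y) \<and> u \<le> 0"
        by (intro exI[of _ "4 * A / X y - z"]) simp
    qed
    moreover have "H 1 = 0"
      by (simp add: H_def X_def w1)
    ultimately show ?thesis by simp
  qed
  have "D r \<le> D 1"
  proof (rule DERIV_nonneg_imp_nondecreasing[OF r(2)])
    fix y
    assume "r \<le> y" "y \<le> 1"
    then have y: "0 < y" "y \<le> 1"
      using r by auto
    have Xp: "0 < X y"
      using X_ge[OF y] by simp
    have "(w has_real_derivative - 2 / X y) (at y)"
      using w[of y] y by (simp add: X_def)
    moreover have "(X has_real_derivative - 2 * \<mu> * y) (at y)"
      unfolding X_def by (auto intro!: derivative_eq_intros)
    ultimately have "(D has_real_derivative
        real k * (- 2 * \<mu> * y / X y) + (2 * real m + 1) * (1 / y) + (- 2 / X y) / 2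
          + A * (2 * w y * (- 2 / X y)) / 2) (at y)"
      unfolding D_def using y(1) Xp
      by (auto intro!: derivative_eq_intros simp: power2_eq_square)
    moreover have "real k * (- 2 * \<mu> * y / X y) + (2 * real m + 1) * (1 / y) + (- 2 / X y) / 2
          + A * (2 * w y * (- 2 / X y)) / 2 = H y / X y"
    proof -
      have "real k * (- 2 * \<mu> * y / X y) = - 2 * real m * y / X y"
        by (simp add: mult.assoc flip: k\<mu>)
      moreover have "(2 * real m + 1) * (1 / y) = (2 * real m + 1) * X y / y / X y"
        using Xp by simp
      ultimately have "real k * (- 2 * \<mu> * y / X y) + (2 * real m + 1) * (1 / y) + (- 2 / X y) / 2
          + A * (2 * w y * (- 2 / X y)) / 2
          = - 2 * real m * y / X y + (2 * real m + 1) * X y / y / X y + (- 2 / X y) / 2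
          + A * (2 * w y * (- 2 / X y)) / 2"
        by (simp only:)
      also have "\<dots> = H y / X y"
        by (simp add: H_def diff_divide_distrib)
      finally show ?thesis .
    qed
    ultimately show "\<exists>u. (D has_real_derivative u) (at y) \<and> 0 \<le> u"
      using H_nonneg[OF y] Xp by (intro exI[of _ "H y / X y"]) simp
  qed
  also have "D 1 = 0"
    by (simp add: D_def X_def w1)
  finally have "real k * ln (X r) + real (2 * m + 1) * ln r \<le> - w r / 2 - A * (w r)\<^sup>2 / 2"
    by (simp add: D_def algebra_simps)
  moreover have "exp (real k * ln (X r) + real (2 * m + 1) * ln r) = X r ^ k * r ^ (2 * m + 1)"
    using X_ge[OF r] r(1) unfolding exp_add exp_of_nat_mult by simp
  ultimately show ?thesis
    unfolding X_def[symmetric] by (metis X_def exp_le_cancel_iff)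
qed

section \<open>Comparison of the distribution function with the Gaussian integral\<close>

lemma binom_cdf_le_gaussian:
  fixes k m n :: nat and \<mu> A p :: real
  assumes k: "0 < k" and m: "0 < m" and n: "n = k + m"
    and \<mu>: "\<mu> = real m / real k" and p: "p = real k / real n"
    and A: "A = 1 / 4 + real m + (real m + 1 / 2) * \<mu>"
  shows "binom_cdf n (k - 1) p \<le> binom_prob n (k - 1) p *
    ((real m + 1) * (sqrt (pi / 2) / sqrt A * (1 + 1 / (8 * A)) - 1 / (2 * A)))"
proof -
  have \<mu>_pos: "0 < \<mu>"
    using k m \<mu> by simp
  have A_pos: "0 < A"
    using \<mu>_pos by (simp add: A add_pos_nonneg)
  have pq: "0 < p" "0 < 1 - p" "1 - p = p * \<mu>"
    using k m by (auto simp: p n \<mu> field_simps)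
  obtain w where w1: "w 1 = 0"
    and w: "\<And>r. 0 \<le> r \<Longrightarrow> r \<le> 1 \<Longrightarrow> (w has_real_derivative - 2 / (1 + \<mu> - \<mu> * r\<^sup>2)) (at r)"
    and w_nonneg: "\<And>r. 0 \<le> r \<Longrightarrow> r \<le> 1 \<Longrightarrow> 0 \<le> w r"
    using artanh_primitive[OF \<mu>_pos] by blast
  obtain g where g0: "g 0 = 0"
    and g: "\<And>w. 0 \<le> w \<Longrightarrow> (g has_real_derivative exp (- A * w\<^sup>2 / 2) * (1 - w / 2 + w\<^sup>2 / 8)) (at w)"
    and g_le: "\<And>w. 0 \<le> w \<Longrightarrow> g w \<le> sqrt (pi / 2) / sqrt A * (1 + 1 / (8 * A)) - 1 / (2 * A)"
    using gaussian_primitive[OF A_pos] by blast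
  define b where "b = binom_prob n (k - 1) p"
  have b_nonneg: "0 \<le> b"
    using pq by (simp add: b_def binom_prob_def)
  \<comment> \<open>As \<open>r\<close> runs from 0 to 1, the argument of the distribution function
    runs from 1 down to \<open>p\<close>. Monotonicity of \<open>T\<close> thus replaces integration
    along this path followed by substitution of \<open>w\<close>.\<close>
  define T where "T = (\<lambda>r. binom_cdf n (k - 1) (1 - (1 - p) * r\<^sup>2) + b * (real m + 1) * g (w r))"
  have "T 1 \<le> T 0"
  proof (rule DERIV_nonpos_imp_nonincreasing[of 0 1 T])
    fix r :: real
    assume r: "0 \<le> r" "r \<le> 1"
    define X where "X = 1 + \<mu> - \<mu> * r\<^sup>2"
    define G where "G = exp (- A * (w r)\<^sup>2 / 2) * (1 - w r / 2 + (w r)\<^sup>2 / 8)"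
    have X_pos: "0 < X"
    proof -
      have "\<mu> * r\<^sup>2 \<le> \<mu>"
        using \<mu>_pos r by (simp add: mult_left_le power_le_one)
      then show ?thesis by (simp add: X_def)
    qed
    have weight: "X ^ k * r ^ (2 * m + 1) \<le> G"
    proof (cases "r = 0")
      case True
      have "0 \<le> exp (- (w r / 2))" by simp
      also have "\<dots> \<le> 1 - w r / 2 + (w r / 2)\<^sup>2 / 2"
        using w_nonneg[OF r] by (intro exp_minus_le_quadratic) simp
      finally show ?thesis
        using True by (simp add: G_def power_divide)
    next
      case False
      then have "X ^ k * r ^ (2 * m + 1) \<le> exp (- w r / 2 - A * (w r)\<^sup>2 / 2)"
        unfolding X_def using r by (intro weight_le_gaussian[OF k m \<mu> A w1 w]) auto
      also have "\<dots> = exp (- A * (w r)\<^sup>2 / 2) * exp (- (w r / 2))"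
        by (simp flip: exp_add)
      also have "\<dots> \<le> exp (- A * (w r)\<^sup>2 / 2) * (1 - w r / 2 + (w r / 2)\<^sup>2 / 2)"
        using w_nonneg[OF r] by (intro mult_left_mono exp_minus_le_quadratic) auto
      finally show ?thesis
        by (simp add: G_def power_divide)
    qed
    have inner: "((\<lambda>r. 1 - (1 - p) * r\<^sup>2) has_real_derivative - 2 * (1 - p) * r) (at r)"
      by (auto intro!: derivative_eq_intros simp: algebra_simps)
    have idx: "k - 1 \<le> n" "n - (k - 1) = m + 1" "n - (k - 1) - 1 = m"
      using k n by auto
    have "((\<lambda>r. binom_cdf n (k - 1) (1 - (1 - p) * r\<^sup>2)) has_real_derivative
        - (real (m + 1) * real (n choose (k - 1)) * (1 - (1 - p) * r\<^sup>2) ^ (k - 1)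
            * (1 - (1 - (1 - p) * r\<^sup>2)) ^ m) * (- 2 * (1 - p) * r)) (at r)"
      using binom_cdf_has_derivative[OF idx(1), of "1 - (1 - p) * r\<^sup>2"] inner
      unfolding idx(2,3) add_diff_cancel_right' by (rule DERIV_chain2)
    also have "- (real (m + 1) * real (n choose (k - 1)) * (1 - (1 - p) * r\<^sup>2) ^ (k - 1)
            * (1 - (1 - (1 - p) * r\<^sup>2)) ^ m) * (- 2 * (1 - p) * r)
        = 2 * (real m + 1) * b * (X ^ (k - 1) * r ^ (2 * m + 1))"
    proof -
      \<comment> \<open>Since \<open>1 - p = p * \<mu>\<close>, the powers of \<open>p\<close> and
        \<open>1 - p\<close> split off and recombine to \<open>b\<close>.\<close>
      have "1 - (1 - p) * r\<^sup>2 = p * X"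
      proof -
        have "p * X = p + p * \<mu> - p * \<mu> * r\<^sup>2"
          by (simp add: X_def algebra_simps)
        then show ?thesis
          by (simp flip: pq(3))
      qed
      moreover have "1 - (1 - (1 - p) * r\<^sup>2) = (1 - p) * r\<^sup>2"
        by simp
      moreover have "b = real (n choose (k - 1)) * p ^ (k - 1) * (1 - p) ^ (m + 1)"
        using k n by (simp add: b_def binom_prob_def)
      moreover have "- (M * C * (p * X) ^ j * (q * r\<^sup>2) ^ m) * (- 2 * q * r)
          = 2 * M * (C * p ^ j * q ^ (m + 1)) * (X ^ j * r ^ (2 * m + 1))" for M C q j
        by (simp add: power_mult_distrib ac_simps flip: power_mult)
      moreover have "real (m + 1) = real m + 1"
        by simp
      ultimately show ?thesis
        by metis
    qed
    finally have dB: "((\<lambda>r. binom_cdf n (k - 1) (1 - (1 - p) * r\<^sup>2)) has_real_derivative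
        2 * (real m + 1) * b * (X ^ (k - 1) * r ^ (2 * m + 1))) (at r)" .
    have dg: "((\<lambda>r. b * (real m + 1) * g (w r)) has_real_derivative
        b * (real m + 1) * (G * (- 2 / X))) (at r)"
      unfolding G_def X_def
      by (intro DERIV_cmult DERIV_chain2[where f = g] g w_nonneg w r)
    have "(T has_real_derivative 2 * (real m + 1) * b * (X ^ (k - 1) * r ^ (2 * m + 1))
        + b * (real m + 1) * (G * (- 2 / X))) (at r)"
      unfolding T_def using dB dg by (rule DERIV_add)
    moreover have "2 * (real m + 1) * b * (X ^ (k - 1) * r ^ (2 * m + 1))
        + b * (real m + 1) * (G * (- 2 / X))
        = 2 * (real m + 1) * b * (X ^ (k - 1) * r ^ (2 * m + 1) - G / X)"
      by (simp add: algebra_simps add_divide_distrib)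
    moreover have "X ^ (k - 1) * r ^ (2 * m + 1) \<le> G / X"
    proof -
      have "X ^ k = X * X ^ (k - 1)"
        using k by (simp add: power_eq_if)
      then show ?thesis
        using weight X_pos by (simp add: le_divide_eq mult_ac)
    qed
    then have "2 * (real m + 1) * b * (X ^ (k - 1) * r ^ (2 * m + 1) - G / X) \<le> 0"
      using b_nonneg by (intro mult_nonneg_nonpos) auto
    ultimately show "\<exists>y. (T has_real_derivative y) (at r) \<and> y \<le> 0"
      by auto
  qed simp
  moreover have "T 1 = binom_cdf n (k - 1) p"
    by (simp add: T_def w1 g0)
  \<comment> \<open>Every summand has index below \<open>n\<close>, hence a factor
    \<open>1 - 1\<close> to a positive power.\<close>
  moreover have "binom_cdf n (k - 1) 1 = 0"
    unfolding binom_cdf_def binom_prob_def using k m n by (intro sum.neutral) auto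
  then have "T 0 = b * (real m + 1) * g (w 0)"
    by (simp add: T_def)
  moreover have "b * (real m + 1) * g (w 0) \<le> b * (real m + 1) *
      (sqrt (pi / 2) / sqrt A * (1 + 1 / (8 * A)) - 1 / (2 * A))"
    using b_nonneg by (intro mult_left_mono g_le w_nonneg) auto
  ultimately show ?thesis
    by (simp add: b_def mult.assoc)
qed

section \<open>The numerical inequality between the two bounds\<close>

text \<open>Dividing the bracket by \<open>sqrt (pi / 2) / sqrt A\<close> leaves \<open>Q\<close>.
  Its saving \<open>c * t\<close> has to beat the relative excess \<open>d / A\<close>, which is at
  most \<open>1.52 * t\<close>; since \<open>2 * c > 1.52\<close>, a polynomial inequality in
  \<open>t\<close> alone remains.\<close>

lemma gaussian_bound_less:
  fixes m :: nat and \<mu> A :: real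
  assumes m: "0 < m" and \<mu>: "0 < \<mu>" "\<mu> \<le> real m"
    and A: "A = 1 / 4 + real m + (real m + 1 / 2) * \<mu>"
  shows "(real m + 1) * (sqrt (pi / 2) / sqrt A * (1 + 1 / (8 * A)) - 1 / (2 * A))
    < sqrt (pi / 2) * sqrt ((real m + 1) / (1 + \<mu>))"
proof -
  \<comment> \<open>After squaring, the claim is \<open>Q\<^sup>2 (A + d) < A\<close>, since \<open>A + d = (m + 1) (1 + \<mu>)\<close>.\<close>
  define c where "c = sqrt (2 / pi)"
  define d where "d = 3 / 4 + \<mu> / 2"
  define t where "t = 1 / (2 * sqrt A)"
  define Q where "Q = 1 - c * t + t\<^sup>2 / 2"
  have A_ge: "5 / 4 \<le> A"
    using m \<mu> by (simp add: A add_increasing2)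
  \<comment> \<open>\<open>sqrt (2 / pi)\<close> is about 0.7979.\<close>
  have c: "797 / 1000 \<le> c" "c \<le> 1"
  proof -
    have "(797 / 1000)\<^sup>2 \<le> 2 / pi"
      using pi_approx(2) by (simp add: le_divide_eq power2_eq_square)
    then show "797 / 1000 \<le> c"
      unfolding c_def by (rule real_le_rsqrt)
    show "c \<le> 1"
      using pi_gt3 by (simp add: c_def)
  qed
  \<comment> \<open>From \<open>5 / 4 \<le> A\<close>, \<open>t\<close> is at most
    \<open>1 / sqrt 5\<close>, about 0.447.\<close>
  have t: "0 < t" "t\<^sup>2 = 1 / (4 * A)" "t \<le> 45 / 100"
  proof -
    show "0 < t" "t\<^sup>2 = 1 / (4 * A)"
      using A_ge by (auto simp: t_def power_divide power_mult_distrib)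
    then have "t\<^sup>2 \<le> (45 / 100)\<^sup>2"
      using A_ge by (simp add: power2_eq_square divide_le_eq)
    then show "t \<le> 45 / 100"
      by (rule power2_le_imp_le) simp
  qed
  \<comment> \<open>At \<open>m = 1\<close>, \<open>\<mu> = 1\<close> the ratio
    \<open>d / sqrt A\<close> is about 0.754, so 0.76 leaves little room. The lower bound for
    \<open>A\<close> uses \<open>1 \<le> m\<close> when \<open>\<mu> \<le> 1\<close>, and
    \<open>\<mu> \<le> m\<close> otherwise.\<close>
  have d: "0 < d" "d\<^sup>2 \<le> (76 / 100)\<^sup>2 * A"
  proof -
    show "0 < d"
      using \<mu> by (simp add: d_def)
    show "d\<^sup>2 \<le> (76 / 100)\<^sup>2 * A"
    proof (cases "\<mu> \<le> 1")
      case True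
      then have "\<mu>\<^sup>2 \<le> \<mu>"
        using \<mu> by (simp add: power2_eq_square mult_left_le)
      moreover have "5 / 4 + 3 / 2 * \<mu> \<le> A"
        unfolding A using m \<mu> by (intro add_mono mult_right_mono) auto
      ultimately show ?thesis
        using True by (simp add: d_def power2_eq_square algebra_simps)
    next
      case False
      have "1 / 4 + \<mu> + (\<mu> + 1 / 2) * \<mu> \<le> A"
        unfolding A using \<mu> by (intro add_mono mult_right_mono) auto
      moreover have "\<mu> \<le> \<mu>\<^sup>2"
        using False by (simp add: power2_eq_square mult_le_cancel_left1)
      moreover have "(\<mu> + 1 / 2) * \<mu> = \<mu>\<^sup>2 + \<mu> / 2" "d\<^sup>2 = 9 / 16 + 3 / 4 * \<mu> + \<mu>\<^sup>2 / 4"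
        by (auto simp: d_def power2_eq_square algebra_simps)
      moreover have "(76 / 100)\<^sup>2 * A = 361 / 625 * A"
        by (simp add: power2_eq_square)
      ultimately show ?thesis
        using False by linarith
    qed
  qed
  have dA: "d / A \<le> 152 / 100 * t"
  proof -
    have "d \<le> 76 / 100 * sqrt A"
      using real_le_rsqrt[OF d(2)] unfolding real_sqrt_mult real_sqrt_abs by simp
    then have "d / A \<le> 76 / 100 * sqrt A / A"
      using A_ge by (intro divide_right_mono) auto
    also have "\<dots> = 152 / 100 * t"
    proof -
      have "sqrt A / A = 1 / sqrt A"
        using A_ge by (simp add: eq_divide_eq)
      then show ?thesis
        by (simp add: t_def)
    qed
    finally show ?thesis .
  qed
  have Q_pos: "0 < Q"
  proof -
    have "c * t \<le> 1 * (45 / 100)"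
      using c t by (intro mult_mono) auto
    then show ?thesis
      by (simp add: Q_def add_pos_nonneg)
  qed
  have "Q\<^sup>2 * (1 + 152 / 100 * t) < 1"
  proof -
    define Q0 where "Q0 = 1 - 797 / 1000 * t + t\<^sup>2 / 2"
    have "Q \<le> Q0"
      using c t by (simp add: Q_def Q0_def)
    then have "Q\<^sup>2 * (1 + 152 / 100 * t) \<le> Q0\<^sup>2 * (1 + 152 / 100 * t)"
      using Q_pos t by (intro mult_right_mono power_mono) auto
    \<comment> \<open>The linear coefficient is \<open>1.52 - 2 * 0.797 = - 0.074\<close>. The
      grouping makes both inner brackets nonnegative for \<open>t \<le> 0.45\<close>; the first
      changes sign only near 0.466.\<close>
    also have "\<dots> = 1 - t * (74 / 1000 + t * (787671 / 1000000 - 168851768 / 100000000 * t)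
        + t ^ 3 * (96144 / 100000 - 38 / 100 * t))"
      unfolding Q0_def by (simp add: power2_eq_square power3_eq_cube field_simps)
    also have "\<dots> < 1"
    proof -
      have "0 \<le> t * (787671 / 1000000 - 168851768 / 100000000 * t)"
        "0 \<le> t ^ 3 * (96144 / 100000 - 38 / 100 * t)"
        using t by auto
      then show ?thesis
        using t(1) by (simp add: add_pos_nonneg)
    qed
    finally show ?thesis .
  qed
  moreover have "Q\<^sup>2 * (1 + d / A) \<le> Q\<^sup>2 * (1 + 152 / 100 * t)"
    using dA by (intro mult_left_mono) auto
  ultimately have "Q\<^sup>2 * (1 + d / A) < 1"
    by linarith
  then have "Q\<^sup>2 * (A + d) < A"
    using A_ge by (simp add: field_simps)
  moreover have "A + d = (real m + 1) * (1 + \<mu>)"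
    by (simp add: A d_def algebra_simps)
  ultimately have QA: "Q\<^sup>2 * ((real m + 1) * (1 + \<mu>)) < A"
    by simp
  have "((real m + 1) * (2 * t * Q))\<^sup>2 = (real m + 1) * (Q\<^sup>2 * (real m + 1) / A)"
    using A_ge by (simp add: power_mult_distrib t(2)) (simp add: power2_eq_square)
  also have "\<dots> < (real m + 1) * (1 / (1 + \<mu>))"
    using QA A_ge \<mu> by (intro mult_strict_left_mono) (auto simp: field_simps)
  finally have "(real m + 1) * (2 * t * Q) < sqrt ((real m + 1) / (1 + \<mu>))"
    by (intro real_less_rsqrt) simp
  then have "sqrt (pi / 2) * ((real m + 1) * (2 * t * Q))
      < sqrt (pi / 2) * sqrt ((real m + 1) / (1 + \<mu>))"
    by (intro mult_strict_left_mono) auto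
  moreover have "sqrt (pi / 2) * ((real m + 1) * (2 * t * Q))
      = (real m + 1) * (sqrt (pi / 2) / sqrt A * (1 + 1 / (8 * A)) - 1 / (2 * A))"
  proof -
    have sc: "sqrt (pi / 2) * c = 1"
      by (simp add: c_def flip: real_sqrt_mult)
    have "sqrt (pi / 2) * (2 * t * Q)
        = sqrt (pi / 2) * (2 * t) * (1 + t\<^sup>2 / 2) - sqrt (pi / 2) * c * (2 * t\<^sup>2)"
      by (simp add: Q_def power2_eq_square algebra_simps)
    also have "\<dots> = sqrt (pi / 2) / sqrt A * (1 + 1 / (8 * A)) - 1 / (2 * A)"
      unfolding sc t(2) by (simp add: t_def)
    finally show ?thesis
      by (simp add: mult.left_commute)
  qed
  ultimately show ?thesis by simp
qed

section \<open>Assembly of the bounds and evaluation of \<open>L\<close>\<close>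

theorem lemma6p2:
  fixes k n :: nat
  assumes "1 \<le> k" and "k \<le> n - 1"
  shows "binom_cdf n (k - 1) (real k / real n) / binom_prob n (k - 1) (real k / real n)
       < sqrt (pi / 2) * L n (k - 1) (real k / real n)"
proof -
  define m where "m = n - k"
  have k: "0 < k" and m: "0 < m" and n: "n = k + m"
    using assms by (auto simp: m_def)
  define \<mu> where "\<mu> = real m / real k"
  define A where "A = 1 / 4 + real m + (real m + 1 / 2) * \<mu>"
  define p where "p = real k / real n"
  define G where "G = (real m + 1) * (sqrt (pi / 2) / sqrt A * (1 + 1 / (8 * A)) - 1 / (2 * A))"
  have \<mu>: "0 < \<mu>" "\<mu> \<le> real m"
    using k m by (auto simp: \<mu>_def divide_le_eq mult_le_cancel_left1)
  have p: "0 < p" "p < 1"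
    using k m by (auto simp: p_def n)
  have b_pos: "0 < binom_prob n (k - 1) p"
    using p n by (simp add: binom_prob_def)
  have "binom_cdf n (k - 1) p \<le> binom_prob n (k - 1) p * G"
    unfolding G_def by (rule binom_cdf_le_gaussian[OF k m n \<mu>_def p_def A_def])
  then have "binom_cdf n (k - 1) p / binom_prob n (k - 1) p \<le> G"
    using b_pos by (simp add: divide_le_eq mult.commute)
  also have "G < sqrt (pi / 2) * sqrt ((real m + 1) / (1 + \<mu>))"
    unfolding G_def by (rule gaussian_bound_less[OF m \<mu> A_def])
  also have "sqrt ((real m + 1) / (1 + \<mu>)) = L n (k - 1) p"
  proof -
    have pn: "p * real n = real k"
      using k n by (simp add: p_def)
    have k1: "real (k - 1) = real k - 1"
      using k by simp
    \<comment> \<open>With \<open>p * n = k\<close> and index \<open>k - 1\<close>, the term outside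
      the root vanishes and the square inside it is \<open>2\<^sup>2\<close>.\<close>
    have "L n (k - 1) p = sqrt (2\<^sup>2 * (1 + (1 - p) * (real k - 1))) / 2"
      unfolding L_def pn k1 by (simp add: algebra_simps)
    also have "\<dots> = sqrt (1 + (1 - p) * (real k - 1))"
      unfolding real_sqrt_mult real_sqrt_abs by simp
    also have "1 + (1 - p) * (real k - 1) = (real m + 1) / (1 + \<mu>)"
      using k by (simp add: p_def n \<mu>_def field_simps)
    finally show ?thesis ..
  qed
  finally show ?thesis
    by (simp add: p_def)
qed

end
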